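(* For $1<\beta<2$ let $c_\beta=\sup_{\mu\in M(X_\beta)}\int_{X_\beta}\chi_{C_1}\,d\mu$. Then the following hold. (1) $c_\beta$ is non-decreasing as a function of $\beta\in(1,2)$. (2) Let $\underline1$ be the coefficient sequence of the quasi-greedy expansion of $1$, written as $\underline1=\overline1^{N}\overline0^{M}1\dots$ with positive integers $N,M$. Then $$\frac{N-1}{N}\le c_\beta\le\frac{N}{N+1}\quad\text{if }N\ge2,\qquad\text{and}\qquad\frac1{M+2}\le c_\beta\le\frac1{M+1}\quad\text{if }N=1.$$ (3) If $\beta$ is a multinacci number, i.e. there is a positive integer $N$ such that $\beta^{N+1}-\beta^N-\dots-1=0$, then $\underline1=\overline{\overline1^{N}0}^\infty$ and $c_\beta=N/(N+1)$. (4) If $\beta$ is a Parry number satisfying $\beta^{M+1}-\beta^M-1=0$ for some positive integer $M$, then $\underline1=\overline{1\overline0^{M}}^\infty$ and $c_\beta=1/(M+1)$.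
   Context: For $1<\beta<2$, $\tau_\beta(x)=\beta x-[\beta x]$ on $[0,1]$ and $g_n(x)=[\beta\tau_\beta^{n-1}(x)]$ are the greedy digits of $x$. $\{0,1\}^{\mathbb N}$ carries the product topology, the lexicographic order $\preceq$ and the left shift $\sigma$. $\underline1=(q_n(1))_{n\ge1}:=\lim_{y\nearrow1}(g_n(y))_{n\ge1}$ is the coefficient sequence of the quasi-greedy expansion of $1$. The beta-shift is $X_\beta=\{\underline x\in\{0,1\}^{\mathbb N}:\sigma^n(\underline x)\preceq\underline1\ \forall n\ge0\}$ with the map $\sigma$. $M(X_\beta)$ is the set of $\sigma$-invariant Borel probability measures on $X_\beta$; $C_1=\{(x_i)\in X_\beta:x_1=1\}$ and $\chi_{C_1}$ is its indicator function. $\overline a^k$ denotes the word $a\dots a$ of length $k$, and $\overline w^\infty$ denotes the infinite concatenation of the finite word $w$. *)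

theory Defs
  imports
    "HOL-Analysis.Analysis"
    "HOL-Probability.Probability_Measure"
    "HOL-Library.Fun_Lexorder"
    "HOL-Library.Omega_Words_Fun"
begin

text \<open>
  A sequence $(x_n)_{n \ge 1}$ is a function on the naturals whose value at $n$ is $x_{n+1}$.
  The full shift $\{0,1\}^{\mathbb N}$ is the set of functions into \<open>{0, 1}\<close>; its product
  topology is the one inherited from the topology of the type \<^typ>\<open>nat \<Rightarrow> nat\<close>, the product
  of discrete spaces.
\<close>

definition tau :: "real \<Rightarrow> real \<Rightarrow> real" where
  "tau \<beta> x = \<beta> * x - of_int \<lfloor>\<beta> * x\<rfloor>"

definition greedy :: "real \<Rightarrow> real \<Rightarrow> nat \<Rightarrow> nat" where
  "greedy \<beta> x n = nat \<lfloor>\<beta> * (tau \<beta> ^^ n) x\<rfloor>"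

text \<open>
  The limit is taken in the product topology. \<open>THE\<close> replaces \<^const>\<open>Lim\<close>, to which it literally
  unfolds, because \<^typ>\<open>nat \<Rightarrow> nat\<close> is not declared an instance of \<^class>\<open>t2_space\<close>.
\<close>

definition quasi_greedy_one :: "real \<Rightarrow> nat \<Rightarrow> nat" where
  "quasi_greedy_one \<beta> = (THE q. (greedy \<beta> \<longlongrightarrow> q) (at_left 1))"

definition shift :: "(nat \<Rightarrow> nat) \<Rightarrow> (nat \<Rightarrow> nat)" where
  "shift x = (\<lambda>n. x (Suc n))"

text \<open>The order \<open>\<le>\<close> of the function type is pointwise, so it is not the lexicographic order.\<close>

definition lex_le :: "(nat \<Rightarrow> nat) \<Rightarrow> (nat \<Rightarrow> nat) \<Rightarrow> bool" where
  "lex_le x y \<longleftrightarrow> less_fun x y \<or> x = y"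

definition beta_shift :: "real \<Rightarrow> (nat \<Rightarrow> nat) set" where
  "beta_shift \<beta> =
     {x \<in> UNIV \<rightarrow> {0, 1}. \<forall>n. lex_le ((shift ^^ n) x) (quasi_greedy_one \<beta>)}"

definition invariant_measures :: "real \<Rightarrow> (nat \<Rightarrow> nat) measure set" where
  "invariant_measures \<beta> =
     {\<mu>. sets \<mu> = sets (restrict_space borel (beta_shift \<beta>)) \<and> prob_space \<mu> \<and>
         shift \<in> measurable \<mu> \<mu> \<and> distr \<mu> \<mu> shift = \<mu>}"

definition cylinder_one :: "real \<Rightarrow> (nat \<Rightarrow> nat) set" where
  "cylinder_one \<beta> = {x \<in> beta_shift \<beta>. x 0 = 1}"

definition c_beta :: "real \<Rightarrow> real" where
  "c_beta \<beta> = (SUP \<mu>\<in>invariant_measures \<beta>. \<integral>x. indicator (cylinder_one \<beta>) x \<partial>\<mu>)"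

definition begins_with :: "nat list \<Rightarrow> (nat \<Rightarrow> nat) \<Rightarrow> bool" where
  "begins_with w x \<longleftrightarrow> (\<exists>z. x = w \<frown> z)"

text \<open>
  Parry numbers: the greedy expansion of 1 is eventually periodic; an expansion with finitely
  many nonzero digits is the case \<open>v = [0]\<close>.
\<close>

definition parry_number :: "real \<Rightarrow> bool" where
  "parry_number \<beta> \<longleftrightarrow> 1 < \<beta> \<and> (\<exists>u v. v \<noteq> [] \<and> greedy \<beta> 1 = u \<frown> v\<^sup>\<omega>)"

end

theory Submission
  imports Defs "HOL-Probability.Probability_Mass_Function"
begin

text \<open>
  Replacing the floor by the ceiling minus one turns $\tau_\beta$ into a left-continuous map of
  $(0,1]$, and the quasi-greedy expansion of 1 is the itinerary of 1 under it; order comparisons of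
  orbits then become lexicographic comparisons of expansions. If every window of length $p$ in
  $X_\beta$ contains at most $K$ ones, invariance gives $c_\beta \le K/p$; a periodic point of
  $X_\beta$ of period $p$ with $K$ ones per period gives $c_\beta \ge K/p$. The periodic
  points used are $\overline{1^{N-1}0}^\infty$, $\overline{10^{M+1}}^\infty$ and, in the last two
  parts, the expansion of 1 itself.
\<close>

section \<open>Left limits of the greedy expansion\<close>

lemma tendsto_fun_iff:
  fixes f :: "'a \<Rightarrow> 'b \<Rightarrow> 'c::topological_space"
  shows "(f \<longlongrightarrow> l) F \<longleftrightarrow> (\<forall>i. ((\<lambda>x. f x i) \<longlongrightarrow> l i) F)"
  using limitin_componentwise[of "\<lambda>_. euclidean" UNIV f l F]
  by (simp add: euclidean_product_topology)

text \<open>\<open>\<lceil>a\<rceil> - 1\<close> is the left limit of the floor at \<open>a\<close>;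
  when \<open>\<beta> * x\<close> is an integer the value is therefore 1, where \<open>tau\<close>
  would give 0.\<close>

definition left_tau :: "real \<Rightarrow> real \<Rightarrow> real" where
  "left_tau \<beta> x = \<beta> * x - of_int (\<lceil>\<beta> * x\<rceil> - 1)"

definition left_digit :: "real \<Rightarrow> real \<Rightarrow> nat \<Rightarrow> nat" where
  "left_digit \<beta> x n = nat (\<lceil>\<beta> * (left_tau \<beta> ^^ n) x\<rceil> - 1)"

text \<open>The open interval from \<open>\<lceil>a\<rceil> - 1\<close> to \<open>a\<close> contains
  no integer, so the floor is constant just below \<open>a\<close>.\<close>

lemma eventually_floor_at_left:
  assumes "filterlim f (at_left a) F"
  shows "\<forall>\<^sub>F x in F. \<lfloor>f x :: real\<rfloor> = \<lceil>a\<rceil> - 1"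
proof -
  have "\<forall>\<^sub>F z in at_left a. z \<in> {of_int (\<lceil>a\<rceil> - 1)<..<a}"
    by (rule eventually_at_left_real) linarith
  then have "\<forall>\<^sub>F z in at_left a. \<lfloor>z\<rfloor> = \<lceil>a\<rceil> - 1"
    by eventually_elim (auto simp: floor_eq_iff; linarith)
  from eventually_compose_filterlim[OF this assms] show ?thesis .
qed

text \<open>Just below \<open>x\<close> the map \<open>tau \<beta>\<close> is affine with slope
  \<open>\<beta> > 0\<close>, so it approaches its limit strictly from below. Having
  \<open>at_left\<close> also as the target filter is what allows iteration.\<close>

lemma filterlim_tau_at_left:
  assumes "\<beta> > 0"
  shows "filterlim (tau \<beta>) (at_left (left_tau \<beta> x)) (at_left x)"
proof -
  have lin: "filterlim (\<lambda>z. \<beta> * z) (at_left (\<beta> * x)) (at_left x)"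
    using assms
    by (auto simp: filterlim_at eventually_at_filter intro!: tendsto_eq_intros)
  have "filterlim (\<lambda>z. \<beta> * z - of_int (\<lceil>\<beta> * x\<rceil> - 1)) (at_left (left_tau \<beta> x)) (at_left x)"
    unfolding left_tau_def using assms
    by (auto simp: filterlim_at eventually_at_filter intro!: tendsto_eq_intros)
  moreover have "\<forall>\<^sub>F z in at_left x. \<beta> * z - of_int (\<lceil>\<beta> * x\<rceil> - 1) = tau \<beta> z"
    using eventually_floor_at_left[OF lin] by eventually_elim (simp add: tau_def)
  ultimately show ?thesis
    by (subst (asm) filterlim_cong[OF refl refl])
qed

lemma filterlim_tau_funpow_at_left:
  assumes "\<beta> > 0"
  shows "filterlim (tau \<beta> ^^ n) (at_left ((left_tau \<beta> ^^ n) x)) (at_left x)"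
proof (induction n)
  case (Suc n)
  show ?case
    using filterlim_compose[OF filterlim_tau_at_left[OF assms] Suc] by (simp add: o_def)
qed (simp add: filterlim_ident id_def)

lemma tendsto_greedy_at_left:
  assumes "\<beta> > 0"
  shows "(greedy \<beta> \<longlongrightarrow> left_digit \<beta> x) (at_left x)"
  unfolding tendsto_fun_iff
proof
  fix n
  let ?r = "(left_tau \<beta> ^^ n) x"
  have "filterlim (\<lambda>z. \<beta> * z) (at_left (\<beta> * ?r)) (at_left ?r)"
    using assms by (auto simp: filterlim_at eventually_at_filter intro!: tendsto_eq_intros)
  from filterlim_compose[OF this filterlim_tau_funpow_at_left[OF assms]]
  have "\<forall>\<^sub>F z in at_left x. \<lfloor>\<beta> * (tau \<beta> ^^ n) z\<rfloor> = \<lceil>\<beta> * ?r\<rceil> - 1"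
    by (rule eventually_floor_at_left)
  then have "\<forall>\<^sub>F z in at_left x. greedy \<beta> z n = left_digit \<beta> x n"
    by eventually_elim (simp add: greedy_def left_digit_def)
  then show "((\<lambda>z. greedy \<beta> z n) \<longlongrightarrow> left_digit \<beta> x n) (at_left x)"
    by (rule tendsto_eventually)
qed

text \<open>Existence of the limit is the preceding lemma; uniqueness is checked in each coordinate,
  where \<open>nat\<close> is Hausdorff.\<close>

lemma quasi_greedy_one_eq:
  assumes "\<beta> > 0"
  shows "quasi_greedy_one \<beta> = left_digit \<beta> 1"
  unfolding quasi_greedy_one_def
proof (rule the_equality)
  show "(greedy \<beta> \<longlongrightarrow> left_digit \<beta> 1) (at_left 1)"
    by (rule tendsto_greedy_at_left[OF assms])
next
  fix q assume "(greedy \<beta> \<longlongrightarrow> q) (at_left 1)"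
  then have "((\<lambda>y. greedy \<beta> y n) \<longlongrightarrow> q n) (at_left 1)" for n
    by (simp add: tendsto_fun_iff)
  moreover have "((\<lambda>y. greedy \<beta> y n) \<longlongrightarrow> left_digit \<beta> 1 n) (at_left 1)" for n
    using tendsto_greedy_at_left[OF assms, of 1] by (simp add: tendsto_fun_iff)
  ultimately have "q n = left_digit \<beta> 1 n" for n
    by (rule tendsto_unique[OF trivial_limit_at_left_real])
  then show "q = left_digit \<beta> 1" ..
qed

section \<open>Orbits and digits under the left-continuous map\<close>

lemma left_tau_bounds: "0 < left_tau \<beta> x" "left_tau \<beta> x \<le> 1"
  unfolding left_tau_def by linarith+

lemma left_tau_funpow_bounds:
  assumes "x \<in> {0<..1}"
  shows "(left_tau \<beta> ^^ n) x \<in> {0<..1}"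
  using assms by (cases n) (auto simp: left_tau_bounds)

text \<open>The orbit stays in \<open>{0<..1}\<close>, so \<open>\<beta> * r\<close> lies strictly
  between 0 and 2 and its ceiling is 1 or 2. The borderline value 1 gets digit 0, unlike in the
  greedy expansion.\<close>

lemma left_digit_binary:
  assumes "\<beta> \<in> {1<..<2}" "x \<in> {0<..1}"
  shows "left_digit \<beta> x n = (if \<beta> * (left_tau \<beta> ^^ n) x > 1 then 1 else 0)"
proof -
  define r where "r = (left_tau \<beta> ^^ n) x"
  have r: "0 < r" "r \<le> 1"
    using left_tau_funpow_bounds[OF assms(2)] by (auto simp: r_def)
  have "0 < \<beta> * r" "\<beta> * r \<le> \<beta>" "\<beta> < 2"
    using assms r by auto
  then have "0 < \<beta> * r" "\<beta> * r < 2"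
    by linarith+
  then have "\<lceil>\<beta> * r\<rceil> = (if \<beta> * r > 1 then 2 else 1)"
    by (auto simp: ceiling_eq_iff)
  then show ?thesis
    by (simp add: left_digit_def r_def)
qed

lemma left_tau_funpow_Suc:
  assumes "\<beta> \<in> {1<..<2}" "x \<in> {0<..1}"
  shows "(left_tau \<beta> ^^ Suc n) x = \<beta> * (left_tau \<beta> ^^ n) x - real (left_digit \<beta> x n)"
proof -
  \<comment> \<open>Positivity makes the ceiling at least 1, so \<open>nat\<close> in
    \<open>left_digit\<close> truncates nothing.\<close>
  have "0 < \<beta> * (left_tau \<beta> ^^ n) x"
    using assms left_tau_funpow_bounds[OF assms(2)] by auto
  then show ?thesis
    by (simp add: left_tau_def left_digit_def)
qed

section \<open>Lexicographic comparison of expansions\<close>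

lemma shift_funpow: "(shift ^^ n) x = (\<lambda>k. x (n + k))"
  by (induction n) (auto simp: shift_def)

lemma shift_left_digit: "(shift ^^ n) (left_digit \<beta> x) = left_digit \<beta> ((left_tau \<beta> ^^ n) x)"
  by (simp add: shift_funpow left_digit_def fun_eq_iff funpow_add add.commute[of n])

lemma lex_le_refl [simp]: "lex_le x x"
  by (simp add: lex_le_def)

text \<open>At the least index of disagreement the assumption gives \<open>\<le>\<close>, and the
  disagreement makes it strict.\<close>

lemma lex_leI_first_difference:
  assumes "\<And>n. (\<And>k. k < n \<Longrightarrow> x k = y k) \<Longrightarrow> x n \<le> y n"
  shows "lex_le x y"
proof (cases "x = y")
  case False
  define n where "n = (LEAST n. x n \<noteq> y n)"
  have "\<exists>n. x n \<noteq> y n"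
    using False by auto
  then have "x n \<noteq> y n" and eq: "\<And>k. k < n \<Longrightarrow> x k = y k"
    unfolding n_def by (fact LeastI_ex) (use not_less_Least in blast)
  then have "x n < y n"
    using assms[of n] by fastforce
  with eq show ?thesis
    by (auto simp: lex_le_def less_fun_def)
qed simp

lemma lex_le_trans:
  assumes "lex_le x y" "lex_le y z"
  shows "lex_le x z"
  using assms less_fun_trans by (auto simp: lex_le_def)

text \<open>As long as the digits agree, the two orbits keep their order.\<close>

lemma lex_le_left_digit:
  assumes "1 < \<beta>" "\<beta> \<le> \<beta>'" "\<beta>' < 2" "0 < x" "x \<le> y" "y \<le> 1"
  shows "lex_le (left_digit \<beta> x) (left_digit \<beta>' y)"
proof (rule lex_leI_first_difference)
  fix n assume eq: "\<And>k. k < n \<Longrightarrow> left_digit \<beta> x k = left_digit \<beta>' y k"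
  have range: "\<beta> \<in> {1<..<2}" "\<beta>' \<in> {1<..<2}" "x \<in> {0<..1}" "y \<in> {0<..1}"
    using assms by auto
  have pos: "0 \<le> (left_tau \<beta> ^^ k) x" for k
    using left_tau_funpow_bounds[OF range(3)] by (auto intro: less_imp_le)
  have "k \<le> n \<Longrightarrow> (left_tau \<beta> ^^ k) x \<le> (left_tau \<beta>' ^^ k) y" for k
  proof (induction k)
    case (Suc k)
    then have "\<beta> * (left_tau \<beta> ^^ k) x \<le> \<beta>' * (left_tau \<beta>' ^^ k) y"
      using assms pos by (intro mult_mono) auto
    with Suc.prems eq[of k] show ?case
      by (simp only: left_tau_funpow_Suc[OF range(1,3)] left_tau_funpow_Suc[OF range(2,4)])
  qed (use assms in simp)
  then have "\<beta> * (left_tau \<beta> ^^ n) x \<le> \<beta>' * (left_tau \<beta>' ^^ n) y"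
    using assms pos by (intro mult_mono) auto
  then show "left_digit \<beta> x n \<le> left_digit \<beta>' y n"
    by (simp add: left_digit_binary[OF range(1,3)] left_digit_binary[OF range(2,4)])
qed

section \<open>The beta-shift and the expansion of 1\<close>

text \<open>Comparing the expansions of the same point 1 in both bases shows that the lexicographic
  bound defining the shift grows with the base.\<close>

lemma beta_shift_mono:
  assumes "1 < \<beta>" "\<beta> \<le> \<beta>'" "\<beta>' < 2"
  shows "beta_shift \<beta> \<subseteq> beta_shift \<beta>'"
  using lex_le_left_digit[OF assms, of 1 1] assms
  by (auto simp: beta_shift_def quasi_greedy_one_eq intro: lex_le_trans)

lemma quasi_greedy_one_binary:
  assumes "\<beta> \<in> {1<..<2}"
  shows "quasi_greedy_one \<beta> n \<in> {0, 1}"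
  using assms left_digit_binary[OF assms, of 1] by (auto simp: quasi_greedy_one_eq)

lemma quasi_greedy_one_0:
  assumes "\<beta> \<in> {1<..<2}"
  shows "quasi_greedy_one \<beta> 0 = 1"
  using assms left_digit_binary[OF assms, of 1 0] by (auto simp: quasi_greedy_one_eq)

text \<open>A tail of the expansion of 1 is the expansion of an orbit point, and no orbit point
  exceeds 1.\<close>

lemma quasi_greedy_one_in_beta_shift:
  assumes "\<beta> \<in> {1<..<2}"
  shows "quasi_greedy_one \<beta> \<in> beta_shift \<beta>"
proof -
  have "lex_le ((shift ^^ n) (quasi_greedy_one \<beta>)) (quasi_greedy_one \<beta>)" for n
    using assms left_tau_funpow_bounds[of 1 n \<beta>]
    by (auto simp: quasi_greedy_one_eq shift_left_digit intro!: lex_le_left_digit)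
  with quasi_greedy_one_binary[OF assms] show ?thesis
    unfolding beta_shift_def by blast
qed

text \<open>If all digits were 1, each step would turn the gap \<open>1 - r\<close> into
  \<open>(2 - \<beta>) + \<beta> * (1 - r)\<close>. The gap would grow at least linearly and pass 1,
  while the orbit stays positive.\<close>

lemma quasi_greedy_one_has_0:
  assumes "\<beta> \<in> {1<..<2}"
  shows "\<exists>n. quasi_greedy_one \<beta> n = 0"
proof (rule ccontr)
  assume "\<not> ?thesis"
  then have "quasi_greedy_one \<beta> n = 1" for n
    using quasi_greedy_one_binary[OF assms, of n] by (metis empty_iff insert_iff)
  then have one: "left_digit \<beta> 1 n = 1" for n
    using assms by (simp add: quasi_greedy_one_eq)
  let ?r = "\<lambda>n. (left_tau \<beta> ^^ n) 1"
  have r: "0 < ?r n" "?r n \<le> 1" for n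
    using left_tau_funpow_bounds[of 1 n \<beta>] by auto
  have "real n * (2 - \<beta>) \<le> 1 - ?r n" for n
  proof (induction n)
    case (Suc n)
    have "1 - ?r (Suc n) = (2 - \<beta>) + \<beta> * (1 - ?r n)"
      using left_tau_funpow_Suc[OF assms, of 1 n] one[of n] by (simp add: algebra_simps)
    also have "\<dots> \<ge> (2 - \<beta>) + 1 * (1 - ?r n)"
      using assms r by (intro add_left_mono mult_right_mono) auto
    finally show ?case
      using Suc by (simp add: algebra_simps)
  qed simp
  moreover obtain n :: nat where "1 < real n * (2 - \<beta>)"
    using assms reals_Archimedean3[of "2 - \<beta>"] by auto
  ultimately show False
    using r(1)[of n] by (smt (verit))
qed

text \<open>With only zeros from index \<open>m\<close> on, each step would multiply the orbit by
  \<open>\<beta>\<close>; starting from a positive value, it would leave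
  \<open>{0<..1}\<close>.\<close>

lemma quasi_greedy_one_frequently_1:
  assumes "\<beta> \<in> {1<..<2}"
  shows "\<exists>n\<ge>m. quasi_greedy_one \<beta> n = 1"
proof (rule ccontr)
  assume "\<not> ?thesis"
  then have "quasi_greedy_one \<beta> n = 0" if "n \<ge> m" for n
    using quasi_greedy_one_binary[OF assms, of n] that by auto
  then have zero: "left_digit \<beta> 1 n = 0" if "n \<ge> m" for n
    using assms that by (simp add: quasi_greedy_one_eq)
  let ?r = "\<lambda>n. (left_tau \<beta> ^^ n) 1"
  have r: "0 < ?r n" "?r n \<le> 1" for n
    using left_tau_funpow_bounds[of 1 n \<beta>] by auto
  have eq: "?r (m + n) = \<beta> ^ n * ?r m" for n
  proof (induction n)
    case (Suc n)
    have "?r (Suc (m + n)) = \<beta> * ?r (m + n)"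
      using left_tau_funpow_Suc[OF assms, of 1 "m + n"] zero[of "m + n"] by simp
    then show ?case
      using Suc by simp
  qed simp
  obtain n where "1 / ?r m < \<beta> ^ n"
    using assms real_arch_pow[of \<beta>] by auto
  then have "1 < ?r (m + n)"
    using r(1)[of m] by (simp add: eq field_simps)
  with r(2)[of "m + n"] show False
    by simp
qed

lemma less_fun_imp_lex_le:
  assumes "x k < y k" "\<And>j. j < k \<Longrightarrow> x j = y j"
  shows "lex_le x y"
  using assms by (auto simp: lex_le_def less_fun_def)

lemma not_lex_le:
  assumes "y k < x k" "\<And>j. j < k \<Longrightarrow> x j = y j"
  shows "\<not> lex_le x y"
proof -
  have "less_fun y x"
    using assms by (auto simp: less_fun_def)
  then show ?thesis
    using less_fun_asym less_fun_irrefl by (auto simp: lex_le_def)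
qed

lemma beta_shift_binary:
  assumes "x \<in> beta_shift \<beta>"
  shows "x k \<in> {0, 1}"
  using assms unfolding beta_shift_def by blast

lemma shift_funpow_in_beta_shift:
  assumes "x \<in> beta_shift \<beta>"
  shows "(shift ^^ n) x \<in> beta_shift \<beta>"
proof -
  have "(shift ^^ m) ((shift ^^ n) x) = (shift ^^ (m + n)) x" for m
    by (simp add: funpow_add)
  moreover have "(shift ^^ n) x \<in> UNIV \<rightarrow> {0, 1}"
    using beta_shift_binary[OF assms] unfolding shift_funpow by blast
  ultimately show ?thesis
    using assms unfolding beta_shift_def by auto
qed

section \<open>Invariant measures and averages over windows\<close>

lemma measurable_shift_borel: "shift \<in> borel_measurable borel"
  unfolding shift_def
  by (intro borel_measurable_continuous_onI continuous_on_coordinatewise_then_product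
      continuous_on_product_coordinates)

lemma measurable_shift_beta_shift:
  "shift \<in> restrict_space borel (beta_shift \<beta>) \<rightarrow>\<^sub>M restrict_space borel (beta_shift \<beta>)"
  using shift_funpow_in_beta_shift[of _ \<beta> 1] measurable_shift_borel
  by (intro measurable_restrict_space2 measurable_restrict_space1) (auto simp: space_restrict_space)

lemma sets_cylinder_one: "cylinder_one \<beta> \<in> sets (restrict_space borel (beta_shift \<beta>))"
proof -
  have "{x. x 0 = 1} \<in> sets (borel :: (nat \<Rightarrow> nat) measure)"
    using open_vimage[OF open_discrete[of "{1 :: nat}"] continuous_on_product_coordinates]
    by (intro borel_open) (simp add: vimage_def)
  moreover have "cylinder_one \<beta> = beta_shift \<beta> \<inter> {x. x 0 = 1}"
    by (auto simp: cylinder_one_def)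
  ultimately show ?thesis
    unfolding sets_restrict_space by blast
qed

text \<open>Turns orbit sums of the indicator into the number of ones in a word.\<close>

lemma indicator_cylinder_one:
  assumes "x \<in> beta_shift \<beta>"
  shows "indicator (cylinder_one \<beta>) ((shift ^^ k) x) = real (x k)"
  using beta_shift_binary[OF assms, of k] shift_funpow_in_beta_shift[OF assms, of k]
  by (auto simp: cylinder_one_def indicator_def shift_funpow)

lemma invariant_measuresD:
  assumes "\<mu> \<in> invariant_measures \<beta>"
  shows "sets \<mu> = sets (restrict_space borel (beta_shift \<beta>))" "space \<mu> = beta_shift \<beta>"
    "prob_space \<mu>" "shift \<in> \<mu> \<rightarrow>\<^sub>M \<mu>" "distr \<mu> \<mu> shift = \<mu>"
    "cylinder_one \<beta> \<in> sets \<mu>"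
  using assms sets_cylinder_one[of \<beta>]
    sets_eq_imp_space_eq[of \<mu> "restrict_space borel (beta_shift \<beta>)"]
  by (auto simp: invariant_measures_def space_restrict_space)

lemma integral_cylinder_one_shift:
  assumes "\<mu> \<in> invariant_measures \<beta>"
  shows "(\<integral>x. indicator (cylinder_one \<beta>) ((shift ^^ k) x) \<partial>\<mu>)
    = (\<integral>x. indicator (cylinder_one \<beta>) x \<partial>\<mu> :: real)"
proof (induction k)
  case (Suc k)
  note [measurable] = invariant_measuresD(4,6)[OF assms]
  \<comment> \<open>Writing \<open>\<mu>\<close> as its own image under \<open>shift\<close> and
    changing variables adds one more shift to the integrand.\<close>
  have "(\<integral>x. indicator (cylinder_one \<beta>) ((shift ^^ k) x) \<partial>\<mu> :: real)
      = (\<integral>x. indicator (cylinder_one \<beta>) ((shift ^^ k) x) \<partial>distr \<mu> \<mu> shift)"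
    by (simp add: invariant_measuresD(5)[OF assms])
  also have "\<dots> = (\<integral>x. indicator (cylinder_one \<beta>) ((shift ^^ k) (shift x)) \<partial>\<mu>)"
    by (rule integral_distr) measurable
  finally show ?case
    using Suc by (simp add: funpow_swap1)
qed simp

text \<open>By invariance all \<open>p\<close> shifted integrals are equal, so \<open>p\<close>
  times the integral is the mean number of ones among the first \<open>p\<close> digits, which
  \<open>window\<close> bounds pointwise by \<open>K\<close>.\<close>

lemma integral_cylinder_one_le:
  assumes \<mu>: "\<mu> \<in> invariant_measures \<beta>" and "p > 0"
    and window: "\<And>x. x \<in> beta_shift \<beta> \<Longrightarrow> (\<Sum>k<p. x k) \<le> K"
  shows "(\<integral>x. indicator (cylinder_one \<beta>) x \<partial>\<mu>) \<le> real K / real p"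
proof -
  interpret prob_space \<mu>
    by (rule invariant_measuresD(3)[OF \<mu>])
  note [measurable] = invariant_measuresD(4,6)[OF \<mu>]
  let ?f = "\<lambda>k x. indicator (cylinder_one \<beta>) ((shift ^^ k) x) :: real"
  have int: "integrable \<mu> (?f k)" for k
    by (rule integrable_const_bound[where B = 1]) auto
  have "real p * (\<integral>x. indicator (cylinder_one \<beta>) x \<partial>\<mu>) = (\<Sum>k<p. \<integral>x. ?f k x \<partial>\<mu>)"
    by (simp add: integral_cylinder_one_shift[OF \<mu>])
  also have "\<dots> = (\<integral>x. (\<Sum>k<p. ?f k x) \<partial>\<mu>)"
    by (simp add: int)
  also have "\<dots> \<le> real K"
  proof (rule integral_le_const)
    have "(\<Sum>k<p. ?f k x) \<le> real K" if "x \<in> beta_shift \<beta>" for x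
    proof -
      have "(\<Sum>k<p. ?f k x) = real (\<Sum>k<p. x k)"
        by (simp add: indicator_cylinder_one[OF that])
      also have "\<dots> \<le> real K"
        using window[OF that] by (rule of_nat_mono)
      finally show ?thesis .
    qed
    then show "AE x in \<mu>. (\<Sum>k<p. ?f k x) \<le> real K"
      by (auto simp: invariant_measuresD(2)[OF \<mu>])
  qed (simp add: int)
  finally show ?thesis
    using \<open>p > 0\<close> by (simp add: field_simps)
qed

text \<open>Windows of length 1 give a crude bound, which makes the set of integrals bounded and its
  supremum usable.\<close>

lemma integral_cylinder_one_le_1:
  assumes "\<mu> \<in> invariant_measures \<beta>"
  shows "(\<integral>x. indicator (cylinder_one \<beta>) x \<partial>\<mu>) \<le> (1 :: real)"
proof -
  have "(\<integral>x. indicator (cylinder_one \<beta>) x \<partial>\<mu>) \<le> real 1 / real 1"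
    by (rule integral_cylinder_one_le[OF assms]) (use beta_shift_binary[of _ \<beta> 0] in force)+
  then show ?thesis
    by simp
qed

lemma bdd_above_integral_cylinder_one:
  "bdd_above ((\<lambda>\<mu>. \<integral>x. indicator (cylinder_one \<beta>) x \<partial>\<mu> :: real) ` invariant_measures \<beta>)"
  by (rule bdd_aboveI2[OF integral_cylinder_one_le_1])

section \<open>Invariant measures on periodic orbits\<close>

lemma periodic_mod:
  fixes y :: "nat \<Rightarrow> 'a"
  assumes "\<And>n. y (n + p) = y n"
  shows "y (n mod p) = y n"
proof -
  have "y (k + j * p) = y k" for k j
  proof (induction j)
    case (Suc j)
    then show ?case
      using assms[of "k + j * p"] by (simp add: ac_simps)
  qed simp
  from this[of "n mod p" "n div p"] show ?thesis
    by simp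
qed

text \<open>The witness is the uniform distribution on the indices below \<open>p\<close>, pushed
  forward to the orbit of \<open>y\<close>. Weighting indices rather than points also covers a
  \<open>p\<close> that is a proper multiple of the least period.\<close>

lemma invariant_measure_periodic:
  assumes y: "y \<in> beta_shift \<beta>" and "p > 0" and per: "\<And>n. y (n + p) = y n"
  shows "\<exists>\<mu>\<in>invariant_measures \<beta>.
    (\<integral>x. indicator (cylinder_one \<beta>) x \<partial>\<mu>) = real (\<Sum>k<p. y k) / real p"
proof
  define P where "P = pmf_of_set {..<p}"
  define M where "M = restrict_space borel (beta_shift \<beta>)"
  define g where "g = (\<lambda>k. (shift ^^ k) y)"
  define \<mu> where "\<mu> = distr (measure_pmf P) M g"
  have ne: "{..<p} \<noteq> {}"
    using \<open>p > 0\<close> by auto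
  have g [measurable]: "g \<in> measure_pmf P \<rightarrow>\<^sub>M M"
    using shift_funpow_in_beta_shift[OF y] by (auto simp: g_def M_def space_restrict_space)
  have s [measurable]: "shift \<in> M \<rightarrow>\<^sub>M M"
    unfolding M_def by (rule measurable_shift_beta_shift)
  \<comment> \<open>Rotation of the indices is injective on a finite set, hence a bijection, and
    preserves the uniform distribution; this becomes shift invariance.\<close>
  have rotate: "map_pmf (\<lambda>k. Suc k mod p) P = P"
    unfolding P_def
  proof (rule map_pmf_of_set_bij_betw)
    have "inj_on (\<lambda>k. Suc k mod p) {..<p}"
      by (rule inj_onI) (auto simp: mod_Suc split: if_splits)
    moreover from this have "(\<lambda>k. Suc k mod p) ` {..<p} = {..<p}"
      using \<open>p > 0\<close> by (intro endo_inj_surj) auto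
    ultimately show "bij_betw (\<lambda>k. Suc k mod p) {..<p} {..<p}"
      by (rule bij_betw_imageI)
  qed (use ne in auto)
  \<comment> \<open>By periodicity the orbit point depends only on the index modulo
    \<open>p\<close>, so the wrap-around at \<open>p - 1\<close> agrees with the shift.\<close>
  have "y (k mod p + n) = y (k + n)" for k n
    using periodic_mod[of y p "k mod p + n"] periodic_mod[of y p "k + n"] per
    by (simp add: mod_simps)
  then have g_mod: "g (k mod p) = g k" for k
    by (simp add: g_def shift_funpow)
  have "distr \<mu> M shift = distr (measure_pmf P) M (\<lambda>k. g (Suc k))"
    unfolding \<mu>_def distr_distr[OF s g] by (simp add: o_def g_def)
  also have "\<dots> = distr (measure_pmf P) M (g \<circ> (\<lambda>k. Suc k mod p))"
    by (simp add: o_def g_mod)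
  also have "\<dots> = distr (measure_pmf (map_pmf (\<lambda>k. Suc k mod p) P)) M g"
    using measurable_space[OF g] unfolding map_pmf_rep_eq by (subst distr_distr) auto
  also have "\<dots> = \<mu>"
    by (simp add: rotate \<mu>_def)
  finally have "distr \<mu> M shift = \<mu>" .
  \<comment> \<open>Invariance is stated with \<open>\<mu>\<close> itself as target;
    \<open>distr\<close> reads only the measurable sets of its target, and those of
    \<open>\<mu>\<close> are those of \<open>M\<close>.\<close>
  moreover have "distr \<mu> \<mu> shift = distr \<mu> M shift"
    by (rule distr_cong) (auto simp: \<mu>_def)
  moreover have "prob_space \<mu>"
    unfolding \<mu>_def by (rule measure_pmf.prob_space_distr) measurable
  moreover have "sets \<mu> = sets M"
    by (simp add: \<mu>_def)
  moreover have "shift \<in> \<mu> \<rightarrow>\<^sub>M \<mu>"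
    unfolding \<mu>_def by simp
  ultimately show "\<mu> \<in> invariant_measures \<beta>"
    by (simp add: invariant_measures_def M_def)
  have [measurable]: "cylinder_one \<beta> \<in> sets M"
    unfolding M_def by (rule sets_cylinder_one)
  have "(\<integral>x. indicator (cylinder_one \<beta>) x \<partial>\<mu> :: real)
      = (\<integral>k. indicator (cylinder_one \<beta>) (g k) \<partial>measure_pmf P)"
    unfolding \<mu>_def by (rule integral_distr) measurable
  also have "\<dots> = (\<integral>k. real (y k) \<partial>measure_pmf P)"
    by (simp add: g_def indicator_cylinder_one[OF y])
  also have "\<dots> = (\<Sum>k<p. real (y k)) / real p"
    unfolding P_def using ne by (subst integral_pmf_of_set) auto
  finally show "(\<integral>x. indicator (cylinder_one \<beta>) x \<partial>\<mu>) = real (\<Sum>k<p. y k) / real p"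
    by simp
qed

text \<open>The zero sequence is a fixed point in the beta-shift and carries an invariant measure;
  upper bounds on the supremum \<open>c_beta\<close> rely on nonemptiness.\<close>

lemma invariant_measures_nonempty:
  assumes "\<beta> \<in> {1<..<2}"
  shows "invariant_measures \<beta> \<noteq> {}"
proof -
  have "lex_le (\<lambda>_. 0) (quasi_greedy_one \<beta>)"
    by (rule lex_leI_first_difference) simp
  then have "(\<lambda>_. 0) \<in> beta_shift \<beta>"
    by (simp add: beta_shift_def shift_funpow)
  from invariant_measure_periodic[OF this, of 1] show ?thesis
    by auto
qed

section \<open>Estimates for \<open>c_beta\<close> and its monotonicity in the base\<close>

lemma c_beta_ge_periodic:
  assumes "y \<in> beta_shift \<beta>" "p > 0" "\<And>n. y (n + p) = y n"
  shows "real (\<Sum>k<p. y k) / real p \<le> c_beta \<beta>"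
  using invariant_measure_periodic[OF assms] bdd_above_integral_cylinder_one
  unfolding c_beta_def by (metis cSUP_upper)

lemma c_beta_le_window:
  assumes "\<beta> \<in> {1<..<2}" "p > 0" "\<And>x. x \<in> beta_shift \<beta> \<Longrightarrow> (\<Sum>k<p. x k) \<le> K"
  shows "c_beta \<beta> \<le> real K / real p"
  unfolding c_beta_def
  using invariant_measures_nonempty[OF assms(1)] integral_cylinder_one_le[OF _ assms(2,3)]
  by (intro cSUP_least)

text \<open>The witness is the image of \<open>\<mu>\<close> under the inclusion of the smaller
  shift space into the larger one, which commutes with the shift.\<close>

lemma invariant_measures_mono:
  assumes \<mu>: "\<mu> \<in> invariant_measures \<beta>" and sub: "beta_shift \<beta> \<subseteq> beta_shift \<beta>'"
  shows "\<exists>\<nu>\<in>invariant_measures \<beta>'.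
    (\<integral>x. indicator (cylinder_one \<beta>') x \<partial>\<nu> :: real) = (\<integral>x. indicator (cylinder_one \<beta>) x \<partial>\<mu>)"
proof
  note \<mu>D = invariant_measuresD[OF \<mu>]
  define M where "M = restrict_space borel (beta_shift \<beta>')"
  define \<nu> where "\<nu> = distr \<mu> M (\<lambda>x. x)"
  have "(\<lambda>x. x) \<in> restrict_space borel (beta_shift \<beta>) \<rightarrow>\<^sub>M M"
    unfolding M_def using sub
    by (intro measurable_restrict_space2 measurable_restrict_space1) (auto simp: space_restrict_space)
  then have i [measurable]: "(\<lambda>x. x) \<in> \<mu> \<rightarrow>\<^sub>M M"
    using measurable_cong_sets[OF \<mu>D(1) refl] by blast
  have s [measurable]: "shift \<in> M \<rightarrow>\<^sub>M M"
    unfolding M_def by (rule measurable_shift_beta_shift)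
  note [measurable] = \<mu>D(4)
  have "distr \<nu> M shift = distr (distr \<mu> \<mu> shift) M (\<lambda>x. x)"
    unfolding \<nu>_def by (subst (1 2) distr_distr) (auto simp: o_def)
  also have "\<dots> = \<nu>"
    by (simp add: \<mu>D(5) \<nu>_def)
  finally have "distr \<nu> M shift = \<nu>" .
  moreover have "distr \<nu> \<nu> shift = distr \<nu> M shift"
    by (rule distr_cong) (auto simp: \<nu>_def)
  moreover have "prob_space \<nu>"
    unfolding \<nu>_def using \<mu>D(3) by (rule prob_space.prob_space_distr) measurable
  moreover have "sets \<nu> = sets M"
    by (simp add: \<nu>_def)
  moreover have "shift \<in> \<nu> \<rightarrow>\<^sub>M \<nu>"
    unfolding \<nu>_def by simp
  ultimately show "\<nu> \<in> invariant_measures \<beta>'"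
    by (simp add: invariant_measures_def M_def)
  have [measurable]: "cylinder_one \<beta>' \<in> sets M"
    unfolding M_def by (rule sets_cylinder_one)
  have "(\<integral>x. indicator (cylinder_one \<beta>') x \<partial>\<nu> :: real) = (\<integral>x. indicator (cylinder_one \<beta>') x \<partial>\<mu>)"
    unfolding \<nu>_def by (rule integral_distr) measurable
  also have "\<dots> = (\<integral>x. indicator (cylinder_one \<beta>) x \<partial>\<mu>)"
    using sub by (intro Bochner_Integration.integral_cong)
      (auto simp: \<mu>D(2) cylinder_one_def indicator_def)
  finally show "(\<integral>x. indicator (cylinder_one \<beta>') x \<partial>\<nu> :: real)
      = (\<integral>x. indicator (cylinder_one \<beta>) x \<partial>\<mu>)" .
qed

lemma c_beta_mono:
  assumes "1 < \<beta>" "\<beta> \<le> \<beta>'" "\<beta>' < 2"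
  shows "c_beta \<beta> \<le> c_beta \<beta>'"
  unfolding c_beta_def
proof (rule cSUP_mono)
  show "invariant_measures \<beta> \<noteq> {}"
    using assms by (intro invariant_measures_nonempty) auto
  fix \<mu> assume "\<mu> \<in> invariant_measures \<beta>"
  from invariant_measures_mono[OF this beta_shift_mono[OF assms]]
  show "\<exists>\<nu>\<in>invariant_measures \<beta>'. (\<integral>x. indicator (cylinder_one \<beta>) x \<partial>\<mu> :: real)
      \<le> (\<integral>x. indicator (cylinder_one \<beta>') x \<partial>\<nu>)"
    by (metis order_refl)
qed (rule bdd_above_integral_cylinder_one)

section \<open>Counting ones in windows\<close>

lemma sum_binary_less:
  assumes "\<And>k. x k \<in> {0, 1 :: nat}" "i < Suc n" "x i = 0"
  shows "(\<Sum>k<Suc n. x k) \<le> n"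
proof -
  have "(\<Sum>k<Suc n. x k) = (\<Sum>k\<in>{..<Suc n} - {i}. x k)"
    using assms by (subst sum.remove[of _ i]) auto
  also have "\<dots> \<le> (\<Sum>k\<in>{..<Suc n} - {i}. 1)"
    using assms(1) by (intro sum_mono) (metis insert_iff le_numeral_extra(4) singleton_iff zero_le)
  also have "\<dots> = n"
    using assms(2) by simp
  finally show ?thesis .
qed

text \<open>A word of \<open>N + 1\<close> ones would exceed the expansion of 1, which drops to 0 at
  index \<open>N\<close>; so the window contains a zero.\<close>

lemma beta_shift_window_ones:
  assumes q: "quasi_greedy_one \<beta> N = 0" "\<And>k. k < N \<Longrightarrow> quasi_greedy_one \<beta> k = 1"
    and x: "x \<in> beta_shift \<beta>"
  shows "(\<Sum>k<Suc N. x k) \<le> N"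
proof -
  note bin = beta_shift_binary[OF x]
  obtain i where "i < Suc N" "x i = 0"
  proof (rule ccontr)
    assume "\<not> thesis"
    with that have "\<forall>i<Suc N. x i \<noteq> 0"
      by blast
    then have "x k = 1" if "k \<le> N" for k
      using bin[of k] that by (auto simp: less_Suc_eq_le)
    then have "\<not> lex_le x (quasi_greedy_one \<beta>)"
      using q by (intro not_lex_le[of _ N]) auto
    moreover have "lex_le ((shift ^^ 0) x) (quasi_greedy_one \<beta>)"
      using x unfolding beta_shift_def by blast
    ultimately show False
      by simp
  qed
  then show ?thesis
    by (rule sum_binary_less[OF bin])
qed

text \<open>The tail from the first 1 on is bounded by a sequence starting with a 1 and
  \<open>M\<close> zeros, which forces its next \<open>M\<close> digits to be 0; they cover the rest
  of the window.\<close>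

lemma beta_shift_window_zeros:
  assumes \<beta>: "\<beta> \<in> {1<..<2}" and q: "\<And>k. 0 < k \<Longrightarrow> k \<le> M \<Longrightarrow> quasi_greedy_one \<beta> k = 0"
    and x: "x \<in> beta_shift \<beta>"
  shows "(\<Sum>k<Suc M. x k) \<le> 1"
proof (cases "\<exists>i<Suc M. x i \<noteq> 0")
  case True
  note bin = beta_shift_binary[OF x]
  define i where "i = (LEAST i. x i \<noteq> 0)"
  have xi: "x i = 1"
    using True bin[of i] LeastI_ex[of "\<lambda>i. x i \<noteq> 0"] unfolding i_def by blast
  have before: "x j = 0" if "j < i" for j
    using that not_less_Least[of j "\<lambda>i. x i \<noteq> 0"] by (auto simp: i_def)
  have i: "i < Suc M"
    using True before by (metis less_trans linorder_neqE_nat)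
  have after: "x (i + k) = 0" if "0 < k" "k \<le> M" for k
    using that
  proof (induction k rule: less_induct)
    case (less k)
    show ?case
    proof (rule ccontr)
      assume "x (i + k) \<noteq> 0"
      then have "x (i + k) = 1"
        using bin[of "i + k"] by auto
      moreover have "x (i + j) = quasi_greedy_one \<beta> j" if "j < k" for j
        using less that q xi quasi_greedy_one_0[OF \<beta>] by (cases "j = 0") auto
      \<comment> \<open>A 1 at distance \<open>k\<close> would be the first after the leading one:
        the tail agrees with the expansion before \<open>k\<close> and exceeds it at
        \<open>k\<close>.\<close>
      ultimately have "\<not> lex_le ((shift ^^ i) x) (quasi_greedy_one \<beta>)"
        using less.prems q by (intro not_lex_le[of _ k]) (auto simp: shift_funpow)
      with x show False
        unfolding beta_shift_def by blast
    qed
  qed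
  have "x j = 0" if "j \<in> {..<Suc M} - {i}" for j
    using that before[of j] after[of "j - i"] by (cases "j < i") auto
  then have "(\<Sum>k<Suc M. x k) = x i"
    using i by (subst sum.remove[of _ i]) auto
  then show ?thesis
    using xi by simp
qed auto

section \<open>Periodic points and lower bounds\<close>

text \<open>Up to its first zero \<open>z\<close> consists of ones, like \<open>y\<close>, and that
  zero comes while \<open>y\<close> is still 1.\<close>

lemma lex_le_run_of_ones:
  assumes "z i = 0" "i < N" "\<And>k. z k \<le> 1" "\<And>k. k < N \<Longrightarrow> y k = (1::nat)"
  shows "lex_le z y"
proof -
  define n where "n = (LEAST i. z i = 0)"
  have "z n = 0" "n \<le> i"
    using assms(1) unfolding n_def by (auto intro: LeastI Least_le)
  moreover have "z k = 1" if "k < n" for k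
    using that assms(3)[of k] not_less_Least[of k "\<lambda>i. z i = 0"]
    by (auto simp: n_def le_Suc_eq)
  ultimately show ?thesis
    using assms by (intro less_fun_imp_lex_le[of _ n]) auto
qed

text \<open>The periodic point repeats \<open>N - 1\<close> ones and a zero, so every tail has a
  zero among its first \<open>N\<close> digits, where the expansion of 1 has only ones.\<close>

lemma c_beta_ge_ones:
  assumes "N > 0" and q: "\<And>k. k < N \<Longrightarrow> quasi_greedy_one \<beta> k = 1"
  shows "(real N - 1) / real N \<le> c_beta \<beta>"
proof -
  define y where "y = (\<lambda>k. if Suc k mod N = 0 then 0 else 1 :: nat)"
  have "lex_le ((shift ^^ n) y) (quasi_greedy_one \<beta>)" for n
  proof (rule lex_le_run_of_ones[OF _ _ _ q])
    \<comment> \<open>The distance from \<open>n\<close> to the next zero of \<open>y\<close>, whose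
      zeros are the indices \<open>k\<close> with \<open>Suc k\<close> divisible by
      \<open>N\<close>.\<close>
    let ?i = "N - 1 - n mod N"
    have "Suc (n + ?i) = n div N * N + N"
      using \<open>N > 0\<close> mod_less_divisor[of N n] div_mult_mod_eq[of n N] by linarith
    then show "(shift ^^ n) y ?i = 0"
      by (simp add: shift_funpow y_def)
  qed (use \<open>N > 0\<close> in \<open>auto simp: shift_funpow y_def\<close>)
  then have y: "y \<in> beta_shift \<beta>"
    by (auto simp: beta_shift_def y_def)
  obtain n where N: "N = Suc n"
    using \<open>N > 0\<close> gr0_implies_Suc by blast
  have "(\<Sum>k<N. y k) = n"
    by (simp add: N y_def)
  moreover have "y (k + N) = y k" for k
    by (simp add: y_def flip: add_Suc)
  ultimately show ?thesis
    using c_beta_ge_periodic[OF y \<open>N > 0\<close>] by (simp add: N)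
qed

text \<open>\<open>L\<close> is the index of the second 1 in the expansion. The periodic point
  repeats a 1 and \<open>L\<close> zeros: a tail starting at a 1 agrees with the expansion before
  \<open>L\<close> and is smaller there, and any other tail starts with 0.\<close>

lemma c_beta_ge_zeros:
  assumes \<beta>: "\<beta> \<in> {1<..<2}" and "L > 0" and q: "quasi_greedy_one \<beta> L = 1"
    "\<And>k. 0 < k \<Longrightarrow> k < L \<Longrightarrow> quasi_greedy_one \<beta> k = 0"
  shows "1 / (real L + 1) \<le> c_beta \<beta>"
proof -
  define y where "y = (\<lambda>k. if k mod Suc L = 0 then 1 else 0 :: nat)"
  have "lex_le ((shift ^^ n) y) (quasi_greedy_one \<beta>)" for n
  proof (cases "n mod Suc L = 0")
    case False
    then show ?thesis
      using quasi_greedy_one_0[OF \<beta>]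
      by (intro less_fun_imp_lex_le[of _ 0]) (auto simp: shift_funpow y_def)
  next
    case True
    then have "(n + k) mod Suc L = k mod Suc L" for k
      by (metis add_0 mod_add_left_eq)
    then show ?thesis
      using \<open>L > 0\<close> q quasi_greedy_one_0[OF \<beta>]
      by (intro less_fun_imp_lex_le[of _ L]) (auto simp: shift_funpow y_def)
  qed
  then have y: "y \<in> beta_shift \<beta>"
    by (auto simp: beta_shift_def y_def)
  have "(\<Sum>k<Suc L. y k) = 1"
    by (subst sum.lessThan_Suc_shift) (simp add: y_def)
  moreover have "y (k + Suc L) = y k" for k
    by (simp add: y_def del: add_Suc_right)
  ultimately show ?thesis
    using c_beta_ge_periodic[OF y, of "Suc L"] by (simp add: add.commute del: sum.lessThan_Suc)
qed

section \<open>Initial blocks of the expansion of 1\<close>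

lemma begins_with_iff: "begins_with w x \<longleftrightarrow> (\<forall>k<length w. x k = w ! k)"
proof
  assume "\<forall>k<length w. x k = w ! k"
  then have "x = w \<frown> (\<lambda>n. x (n + length w))"
    by (auto simp: conc_def fun_eq_iff)
  then show "begins_with w x"
    unfolding begins_with_def by blast
qed (auto simp: begins_with_def)

lemma begins_with_ones_zeros_one_iff:
  "begins_with (replicate N 1 @ replicate M 0 @ [1]) x \<longleftrightarrow>
    (\<forall>k<N. x k = 1) \<and> (\<forall>k. N \<le> k \<and> k < N + M \<longrightarrow> x k = 0) \<and> x (N + M) = 1"
proof -
  have nth: "(replicate N 1 @ replicate M 0 @ [1 :: nat]) ! k = (if k < N \<or> k = N + M then 1 else 0)"
    if "k < Suc (N + M)" for k
    using that by (auto simp: nth_append less_Suc_eq)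
  show ?thesis
    unfolding begins_with_iff using nth by (auto simp: less_Suc_eq)
qed

text \<open>\<open>N\<close> is the index of the first 0 and \<open>L\<close> that of the next 1;
  they exist because the expansion is neither constantly 1 nor eventually 0.\<close>

lemma quasi_greedy_one_begins_with:
  assumes \<beta>: "\<beta> \<in> {1<..<2}"
  shows "\<exists>N>0. \<exists>M>0.
    begins_with (replicate N 1 @ replicate M 0 @ [1]) (quasi_greedy_one \<beta>)"
proof -
  let ?q = "quasi_greedy_one \<beta>"
  define N where "N = (LEAST n. ?q n = 0)"
  define L where "L = (LEAST n. N \<le> n \<and> ?q n = 1)"
  have N: "?q N = 0"
    unfolding N_def by (rule LeastI_ex) (rule quasi_greedy_one_has_0[OF \<beta>])
  have L: "N \<le> L \<and> ?q L = 1"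
    unfolding L_def by (rule LeastI_ex) (rule quasi_greedy_one_frequently_1[OF \<beta>])
  have "?q k = 1" if "k < N" for k
    using that quasi_greedy_one_binary[OF \<beta>, of k] not_less_Least[of k "\<lambda>n. ?q n = 0"]
    by (auto simp: N_def)
  moreover have "?q k = 0" if "N \<le> k" "k < L" for k
    using that quasi_greedy_one_binary[OF \<beta>, of k]
      not_less_Least[of k "\<lambda>n. N \<le> n \<and> ?q n = 1"]
    by (auto simp: L_def)
  ultimately have "begins_with (replicate N 1 @ replicate (L - N) 0 @ [1]) ?q"
    unfolding begins_with_ones_zeros_one_iff using L by auto
  moreover have "N \<noteq> 0" "L \<noteq> N"
    using quasi_greedy_one_0[OF \<beta>] N L by (metis zero_neq_one)+
  ultimately show ?thesis
    using L by (metis le_neq_implies_less neq0_conv zero_less_diff)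
qed

section \<open>Purely periodic expansions of 1\<close>

text \<open>The orbit of 1 is back at 1 after \<open>length w\<close> steps, so the digits repeat
  and \<open>w\<close> is one period.\<close>

lemma quasi_greedy_one_eq_iter:
  assumes "\<beta> > 0" "w \<noteq> []" "(left_tau \<beta> ^^ length w) 1 = 1"
    and "\<And>k. k < length w \<Longrightarrow> left_digit \<beta> 1 k = w ! k"
  shows "quasi_greedy_one \<beta> = w\<^sup>\<omega>"
proof
  fix n
  have "left_digit \<beta> 1 (k + length w) = left_digit \<beta> 1 k" for k
    using shift_left_digit[of "length w" \<beta> 1] assms(3)
    by (simp add: shift_funpow fun_eq_iff add.commute)
  from periodic_mod[of "left_digit \<beta> 1", OF this, of n]
  show "quasi_greedy_one \<beta> n = w\<^sup>\<omega> n"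
    using assms by (simp add: quasi_greedy_one_eq)
qed

text \<open>The expansion of 1 lies in the beta-shift and serves itself as the periodic
  point.\<close>

lemma c_beta_ge_iter:
  assumes \<beta>: "\<beta> \<in> {1<..<2}" and "w \<noteq> []" and q: "quasi_greedy_one \<beta> = w\<^sup>\<omega>"
  shows "real (sum_list w) / real (length w) \<le> c_beta \<beta>"
proof -
  have "(\<Sum>k<length w. quasi_greedy_one \<beta> k) = sum_list w"
    using \<open>w \<noteq> []\<close> by (simp add: q sum_list_sum_nth atLeast0LessThan)
  moreover have "quasi_greedy_one \<beta> (n + length w) = quasi_greedy_one \<beta> n" for n
    using \<open>w \<noteq> []\<close> by (simp add: q)
  ultimately show ?thesis
    using c_beta_ge_periodic[OF quasi_greedy_one_in_beta_shift[OF \<beta>], of "length w"] \<open>w \<noteq> []\<close>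
    by simp
qed

text \<open>With \<open>x = 1 / \<beta>\<close> the equation says that
  \<open>x + ... + x ^ (N + 1)\<close> is 1. The orbit of 1 descends through the shorter sums:
  multiplying by \<open>\<beta>\<close> and subtracting the digit 1 drops the highest power.\<close>

lemma quasi_greedy_one_multinacci:
  assumes \<beta>: "\<beta> \<in> {1<..<2}" and root: "\<beta> ^ (N + 1) - (\<Sum>i\<le>N. \<beta> ^ i) = 0"
  shows "quasi_greedy_one \<beta> = (replicate N 1 @ [0])\<^sup>\<omega>"
proof (rule quasi_greedy_one_eq_iter)
  define x where "x = 1 / \<beta>"
  have x: "0 < x" "\<beta> * x = 1"
    using \<beta> by (auto simp: x_def)
  have "1 \<in> {0<..1 :: real}"
    by simp
  note Suc_orbit = left_tau_funpow_Suc[OF \<beta> this] and digit = left_digit_binary[OF \<beta> this]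
  let ?r = "\<lambda>k. (left_tau \<beta> ^^ k) 1"
  let ?s = "\<lambda>m. \<Sum>j<m. x ^ Suc j"
  have s_Suc: "\<beta> * ?s (Suc m) = 1 + ?s m" for m
  proof -
    have "\<beta> * ?s (Suc m) = (\<Sum>j<Suc m. x ^ j)"
      unfolding sum_distrib_left using x(2) by (intro sum.cong) (auto simp flip: mult.assoc)
    then show ?thesis
      by (simp add: sum.lessThan_Suc_shift del: sum.lessThan_Suc)
  qed
  have s_pos: "0 < ?s (Suc m)" for m
    using x(1) by (intro sum_pos) auto
  have start: "?s (Suc N) = 1"
  proof -
    \<comment> \<open>Dividing the equation by \<open>\<beta> ^ Suc N\<close> turns its powers of
      \<open>\<beta>\<close>, in reverse order, into the powers of \<open>x\<close>.\<close>
    have "x ^ Suc j = \<beta> ^ (Suc N - Suc j) / \<beta> ^ Suc N" if "j < Suc N" for j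
    proof -
      have "\<beta> ^ (Suc N - Suc j) * \<beta> ^ Suc j = \<beta> ^ Suc N"
        using that by (simp only: flip: power_add) simp
      then show ?thesis
        using \<beta> by (simp add: x_def power_divide frac_eq_eq del: power_Suc)
    qed
    then have "?s (Suc N) = (\<Sum>j<Suc N. \<beta> ^ (Suc N - Suc j) / \<beta> ^ Suc N)"
      by (intro sum.cong) auto
    also have "\<dots> = (\<Sum>i<Suc N. \<beta> ^ i) / \<beta> ^ Suc N"
      by (simp only: sum.nat_diff_reindex flip: sum_divide_distrib)
    also have "\<dots> = 1"
    proof -
      have "(\<Sum>i<Suc N. \<beta> ^ i) = \<beta> ^ Suc N"
        using root by (simp add: lessThan_Suc_atMost)
      then show ?thesis
        using \<beta> by (simp del: sum.lessThan_Suc power_Suc)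
    qed
    finally show ?thesis .
  qed
  have orbit: "?r k = ?s (Suc N - k)" if "k \<le> N" for k
    using that
  proof (induction k)
    case 0
    then show ?case
      using start by simp
  next
    case (Suc k)
    then obtain m where m: "N - k = Suc m"
      by (metis Suc_diff_Suc Suc_le_lessD)
    with Suc have "?r k = ?s (Suc (Suc m))"
      by (simp add: Suc_diff_le del: sum.lessThan_Suc)
    then have "\<beta> * ?r k = 1 + ?s (Suc m)"
      by (simp only: s_Suc)
    then show ?case
      using Suc_orbit[of k] digit[of k] s_pos[of m] m by simp
  qed
  have digit_1: "left_digit \<beta> 1 k = 1" if "k < N" for k
  proof -
    have "Suc N - k = Suc (Suc (N - Suc k))"
      using that by linarith
    with that have "\<beta> * ?r k = 1 + ?s (Suc (N - Suc k))"
      by (simp only: orbit[OF less_imp_le] s_Suc)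
    then show ?thesis
      using s_pos[of "N - Suc k"] by (simp add: digit)
  qed
  \<comment> \<open>The last sum is \<open>x\<close> alone, so the product is exactly 1: the strict
    test gives digit 0, and the orbit returns to 1.\<close>
  have "\<beta> * ?r N = 1"
    using orbit[of N] x(2) by simp
  then have digit_0: "left_digit \<beta> 1 N = 0" and "?r (Suc N) = 1"
    using Suc_orbit[of N] digit[of N] by auto
  then show "(left_tau \<beta> ^^ length (replicate N (1 :: nat) @ [0])) 1 = 1"
    by simp
  show "left_digit \<beta> 1 k = (replicate N 1 @ [0]) ! k"
    if "k < length (replicate N (1 :: nat) @ [0])" for k
    using that digit_0 digit_1 by (auto simp: nth_append less_Suc_eq)
qed (use \<beta> in auto)

text \<open>After the first digit the orbit is at \<open>\<beta> - 1\<close> and grows by the factor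
  \<open>\<beta>\<close> with digit 0, until the equation in the form
  \<open>\<beta> ^ M * (\<beta> - 1) = 1\<close> brings it back to 1.\<close>

lemma quasi_greedy_one_simple_sparse:
  assumes \<beta>: "\<beta> \<in> {1<..<2}" and root: "\<beta> ^ (M + 1) - \<beta> ^ M - 1 = 0"
  shows "quasi_greedy_one \<beta> = (1 # replicate M 0)\<^sup>\<omega>"
proof (rule quasi_greedy_one_eq_iter)
  have "1 \<in> {0<..1 :: real}"
    by simp
  note Suc_orbit = left_tau_funpow_Suc[OF \<beta> this] and digit = left_digit_binary[OF \<beta> this]
  let ?r = "\<lambda>k. (left_tau \<beta> ^^ k) 1"
  have root': "\<beta> ^ M * (\<beta> - 1) = 1"
    using root by (simp add: algebra_simps)
  \<comment> \<open>Equality holds for \<open>k = M - 1\<close>; the digit is still 0 there, since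
    only products above 1 give digit 1.\<close>
  have small: "\<beta> * (\<beta> ^ k * (\<beta> - 1)) \<le> 1" if "k < M" for k
  proof -
    have "\<beta> ^ Suc k * (\<beta> - 1) \<le> \<beta> ^ M * (\<beta> - 1)"
      using \<beta> that by (intro mult_right_mono power_increasing) auto
    then show ?thesis
      by (simp add: root' mult.assoc)
  qed
  have first: "left_digit \<beta> 1 0 = 1"
    using \<beta> digit[of 0] by simp
  have orbit: "?r (Suc k) = \<beta> ^ k * (\<beta> - 1)" if "k \<le> M" for k
    using that
  proof (induction k)
    case 0
    then show ?case
      using Suc_orbit[of 0] first by simp
  next
    case (Suc k)
    then have r: "?r (Suc k) = \<beta> ^ k * (\<beta> - 1)"
      by simp
    moreover have "left_digit \<beta> 1 (Suc k) = 0"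
      using small[of k] Suc.prems unfolding digit r by simp
    ultimately show ?case
      using Suc_orbit[of "Suc k"] by (simp add: mult.assoc)
  qed
  have rest: "left_digit \<beta> 1 (Suc k) = 0" if "k < M" for k
    using small[OF that] that unfolding digit orbit[OF less_imp_le[OF that]] by simp
  show "(left_tau \<beta> ^^ length (1 # replicate M (0 :: nat))) 1 = 1"
    using orbit[of M] root' by simp
  show "left_digit \<beta> 1 k = (1 # replicate M 0) ! k"
    if "k < length (1 # replicate M (0 :: nat))" for k
    using that first rest by (cases k) auto
qed (use \<beta> in auto)

section \<open>Upper bounds and assembly of the four statements\<close>

lemma c_beta_le_ones:
  assumes \<beta>: "\<beta> \<in> {1<..<2}" and q: "quasi_greedy_one \<beta> N = 0"
    "\<And>k. k < N \<Longrightarrow> quasi_greedy_one \<beta> k = 1"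
  shows "c_beta \<beta> \<le> real N / (real N + 1)"
  using c_beta_le_window[OF \<beta>, of "Suc N" N] beta_shift_window_ones[OF q]
  by (simp add: add.commute)

lemma c_beta_le_zeros:
  assumes \<beta>: "\<beta> \<in> {1<..<2}" and q: "\<And>k. 0 < k \<Longrightarrow> k \<le> M \<Longrightarrow> quasi_greedy_one \<beta> k = 0"
  shows "c_beta \<beta> \<le> 1 / (real M + 1)"
  using c_beta_le_window[OF \<beta>, of "Suc M" 1] beta_shift_window_zeros[OF \<beta> q]
  by (simp add: add.commute)

theorem theorem5p2:
  shows "mono_on {1<..<2} c_beta \<and>
    (\<forall>\<beta>\<in>{1<..<2::real}.
      (\<exists>N>0. \<exists>M>0.
        begins_with (replicate N 1 @ replicate M 0 @ [1]) (quasi_greedy_one \<beta>)) \<and>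
      (\<forall>N>0. \<forall>M>0.
        begins_with (replicate N 1 @ replicate M 0 @ [1]) (quasi_greedy_one \<beta>) \<longrightarrow>
        (N \<ge> 2 \<longrightarrow>
          (real N - 1) / real N \<le> c_beta \<beta> \<and> c_beta \<beta> \<le> real N / (real N + 1)) \<and>
        (N = 1 \<longrightarrow>
          1 / (real M + 2) \<le> c_beta \<beta> \<and> c_beta \<beta> \<le> 1 / (real M + 1)))) \<and>
    (\<forall>\<beta>\<in>{1<..<2::real}. \<forall>N>0.
      \<beta> ^ (N + 1) - (\<Sum>i\<le>N. \<beta> ^ i) = 0 \<longrightarrow>
      quasi_greedy_one \<beta> = (replicate N 1 @ [0])\<^sup>\<omega> \<and>
      c_beta \<beta> = real N / (real N + 1)) \<and>
    (\<forall>\<beta>\<in>{1<..<2::real}. \<forall>M>0.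
      parry_number \<beta> \<and> \<beta> ^ (M + 1) - \<beta> ^ M - 1 = 0 \<longrightarrow>
      quasi_greedy_one \<beta> = (1 # replicate M 0)\<^sup>\<omega> \<and>
      c_beta \<beta> = 1 / (real M + 1))"
proof (intro conjI ballI allI impI)
  show "mono_on {1<..<2} c_beta"
    by (rule mono_onI) (auto intro: c_beta_mono)
next
  fix \<beta> :: real assume \<beta>: "\<beta> \<in> {1<..<2}"
  show "\<exists>N>0. \<exists>M>0.
      begins_with (replicate N 1 @ replicate M 0 @ [1]) (quasi_greedy_one \<beta>)"
    by (rule quasi_greedy_one_begins_with[OF \<beta>])
  fix N M :: nat
  assume "0 < N" "0 < M"
    and "begins_with (replicate N 1 @ replicate M 0 @ [1]) (quasi_greedy_one \<beta>)"
  then have q: "\<And>k. k < N \<Longrightarrow> quasi_greedy_one \<beta> k = 1"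
    "\<And>k. N \<le> k \<Longrightarrow> k < N + M \<Longrightarrow> quasi_greedy_one \<beta> k = 0" "quasi_greedy_one \<beta> (N + M) = 1"
    unfolding begins_with_ones_zeros_one_iff by auto
  show "(real N - 1) / real N \<le> c_beta \<beta>"
    using q \<open>0 < N\<close> by (intro c_beta_ge_ones)
  show "c_beta \<beta> \<le> real N / (real N + 1)"
    using q \<open>0 < M\<close> by (intro c_beta_le_ones[OF \<beta>]) auto
  assume "N = 1"
  then show "1 / (real M + 2) \<le> c_beta \<beta>"
    \<comment> \<open>For \<open>N = 1\<close> the second 1 of the expansion stands at index
      \<open>N + M = Suc M\<close>, whence the denominator \<open>M + 2\<close>.\<close>
    using c_beta_ge_zeros[OF \<beta>, of "Suc M"] q by (simp add: add.commute)
  show "c_beta \<beta> \<le> 1 / (real M + 1)"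
    using \<open>N = 1\<close> q by (intro c_beta_le_zeros[OF \<beta>]) auto
next
  fix \<beta> :: real and N :: nat
  assume \<beta>: "\<beta> \<in> {1<..<2}" and "\<beta> ^ (N + 1) - (\<Sum>i\<le>N. \<beta> ^ i) = 0"
  then show q: "quasi_greedy_one \<beta> = (replicate N 1 @ [0])\<^sup>\<omega>"
    by (rule quasi_greedy_one_multinacci)
  \<comment> \<open>The expansion begins with \<open>N\<close> ones and a 0, so the window bound
    equals the frequency of ones in its own period.\<close>
  have "c_beta \<beta> \<le> real N / (real N + 1)"
    by (rule c_beta_le_ones[OF \<beta>]) (auto simp: q nth_append)
  moreover have "real N / (real N + 1) \<le> c_beta \<beta>"
    using c_beta_ge_iter[OF \<beta> _ q] by (simp add: sum_list_replicate add.commute)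
  ultimately show "c_beta \<beta> = real N / (real N + 1)"
    by (rule antisym)
next
  fix \<beta> :: real and M :: nat
  assume \<beta>: "\<beta> \<in> {1<..<2}" and "parry_number \<beta> \<and> \<beta> ^ (M + 1) - \<beta> ^ M - 1 = 0"
  then show q: "quasi_greedy_one \<beta> = (1 # replicate M 0)\<^sup>\<omega>"
    by (intro quasi_greedy_one_simple_sparse) auto
  have "c_beta \<beta> \<le> 1 / (real M + 1)"
    by (rule c_beta_le_zeros[OF \<beta>]) (auto simp: q nth_Cons')
  moreover have "1 / (real M + 1) \<le> c_beta \<beta>"
    using c_beta_ge_iter[OF \<beta> _ q] by (simp add: sum_list_replicate add.commute)
  ultimately show "c_beta \<beta> = 1 / (real M + 1)"
    by (rule antisym)
qed

end
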